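(* There is a functor $\mathbf{op}:\mathcal{C}at\to\mathcal{C}at$ that sends a category to its opposite category, and a functor to its opposite functor.
   Context: $\mathcal{C}at$ is the category whose objects are categories and whose arrows are (covariant) functors. The opposite $\mathcal C^{op}$ of a category $\mathcal C$ has the same objects, an arrow $f^{op}:b\to a$ for every arrow $f:a\to b$ of $\mathcal C$, identities $1_x^{op}$, and composition $f^{op}\circ g^{op}:=(g\circ f)^{op}$. For a functor $F:\mathcal C\to\mathcal D$, the opposite functor $F^{op}:\mathcal C^{op}\to\mathcal D^{op}$ has the same object function as $F$ and sends $f^{op}$ to $(Ff)^{op}$. *)

theory Defs
  imports Main "HOL-Library.FuncSet"
begin

text \<open>
  Categories are given by a set of objects, a set of arrows, and structure maps. The structure maps
  are total HOL functions, so they are required to be \<^term>\<open>undefined\<close> outside their mathematical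
  domain: equality of records is then equality of categories, and likewise for functors below.
\<close>

record ('o, 'a) category =
  Obj :: "'o set"
  Arr :: "'a set"
  Dom :: "'a \<Rightarrow> 'o"
  Cod :: "'a \<Rightarrow> 'o"
  Id :: "'o \<Rightarrow> 'a"
  Comp :: "'a \<Rightarrow> 'a \<Rightarrow> 'a"  \<comment> \<open>\<open>Comp C g f\<close> is $g \circ f$\<close>

definition composable :: "('o, 'a) category \<Rightarrow> 'a \<Rightarrow> 'a \<Rightarrow> bool" where
  "composable C g f \<longleftrightarrow> g \<in> Arr C \<and> f \<in> Arr C \<and> Cod C f = Dom C g"

locale category =
  fixes C :: "('o, 'a) category"
  assumes Dom_type: "Dom C \<in> Arr C \<rightarrow>\<^sub>E Obj C"
    and Cod_type: "Cod C \<in> Arr C \<rightarrow>\<^sub>E Obj C"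
    and Id_type: "Id C \<in> Obj C \<rightarrow>\<^sub>E Arr C"
    and Dom_Id: "x \<in> Obj C \<Longrightarrow> Dom C (Id C x) = x"
    and Cod_Id: "x \<in> Obj C \<Longrightarrow> Cod C (Id C x) = x"
    and Comp_closed: "composable C g f \<Longrightarrow> Comp C g f \<in> Arr C"
    and Comp_undefined: "\<not> composable C g f \<Longrightarrow> Comp C g f = undefined"
    and Dom_Comp: "composable C g f \<Longrightarrow> Dom C (Comp C g f) = Dom C f"
    and Cod_Comp: "composable C g f \<Longrightarrow> Cod C (Comp C g f) = Cod C g"
    and Comp_assoc: "composable C h g \<Longrightarrow> composable C g f \<Longrightarrow>
      Comp C (Comp C h g) f = Comp C h (Comp C g f)"
    and Comp_Id_left: "f \<in> Arr C \<Longrightarrow> Comp C (Id C (Cod C f)) f = f"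
    and Comp_Id_right: "f \<in> Arr C \<Longrightarrow> Comp C f (Id C (Dom C f)) = f"

record ('o, 'a, 'p, 'b) cat_functor =
  Source :: "('o, 'a) category"
  Target :: "('p, 'b) category"
  ObjMap :: "'o \<Rightarrow> 'p"
  ArrMap :: "'a \<Rightarrow> 'b"

locale is_functor =
  fixes F :: "('o, 'a, 'p, 'b) cat_functor"
  assumes category_Source: "category (Source F)"
    and category_Target: "category (Target F)"
    and ObjMap_type: "ObjMap F \<in> Obj (Source F) \<rightarrow>\<^sub>E Obj (Target F)"
    and ArrMap_type: "ArrMap F \<in> Arr (Source F) \<rightarrow>\<^sub>E Arr (Target F)"
    and Dom_ArrMap: "f \<in> Arr (Source F) \<Longrightarrow>
      Dom (Target F) (ArrMap F f) = ObjMap F (Dom (Source F) f)"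
    and Cod_ArrMap: "f \<in> Arr (Source F) \<Longrightarrow>
      Cod (Target F) (ArrMap F f) = ObjMap F (Cod (Source F) f)"
    and ArrMap_Id: "x \<in> Obj (Source F) \<Longrightarrow>
      ArrMap F (Id (Source F) x) = Id (Target F) (ObjMap F x)"
    and ArrMap_Comp: "composable (Source F) g f \<Longrightarrow>
      ArrMap F (Comp (Source F) g f) = Comp (Target F) (ArrMap F g) (ArrMap F f)"

definition id_functor :: "('o, 'a) category \<Rightarrow> ('o, 'a, 'o, 'a) cat_functor" where
  "id_functor C =
    \<lparr>Source = C, Target = C, ObjMap = (\<lambda>x\<in>Obj C. x), ArrMap = (\<lambda>f\<in>Arr C. f)\<rparr>"

definition comp_functor ::
  "('p, 'b, 'q, 'c) cat_functor \<Rightarrow> ('o, 'a, 'p, 'b) cat_functor \<Rightarrow> ('o, 'a, 'q, 'c) cat_functor"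
where
  "comp_functor G F =
    \<lparr>Source = Source F, Target = Target G,
     ObjMap = compose (Obj (Source F)) (ObjMap G) (ObjMap F),
     ArrMap = compose (Arr (Source F)) (ArrMap G) (ArrMap F)\<rparr>"

text \<open>
  The category of all categories whose objects are elements of the type \<^typ>\<open>'o\<close> and whose arrows
  are elements of the type \<^typ>\<open>'a\<close>. The two types, which are arbitrary, play the role of the
  universe bounding the size of the objects of $\mathcal{C}at$.
\<close>

definition Cat :: "(('o, 'a) category, ('o, 'a, 'o, 'a) cat_functor) category" where
  "Cat =
    \<lparr>Obj = {C. category C},
     Arr = {F. is_functor F},
     Dom = (\<lambda>F\<in>{F. is_functor F}. Source F),
     Cod = (\<lambda>F\<in>{F. is_functor F}. Target F),
     Id = (\<lambda>C\<in>{C. category C}. id_functor C),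
     Comp = (\<lambda>G F. if is_functor G \<and> is_functor F \<and> Target F = Source G
                   then comp_functor G F else undefined)\<rparr>"

text \<open>
  Since domain and codomain are part of the category rather than of the arrow, the formal arrow
  $f^{op}$ is represented by \<open>f\<close> itself, regarded as an arrow of the opposite category.
\<close>

definition opposite :: "('o, 'a) category \<Rightarrow> ('o, 'a) category" where
  "opposite C =
    \<lparr>Obj = Obj C, Arr = Arr C, Dom = Cod C, Cod = Dom C, Id = Id C,
     Comp = (\<lambda>f g. Comp C g f)\<rparr>"

definition opposite_functor ::
  "('o, 'a, 'p, 'b) cat_functor \<Rightarrow> ('o, 'a, 'p, 'b) cat_functor" where
  "opposite_functor F =
    \<lparr>Source = opposite (Source F), Target = opposite (Target F),
     ObjMap = ObjMap F, ArrMap = ArrMap F\<rparr>"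

end

theory Submission
  imports Defs
begin

text \<open>
  Reversing all arrows of a category exchanges domain with codomain and reverses the order of
  composition, and the category axioms are symmetric under this exchange: the two unit laws trade
  places and associativity is read from right to left. So the opposite of a category is a category,
  and for the same reason a functor is still a functor between the opposite categories.

  Passing to the opposite of a functor changes neither its object map nor its arrow map, only its
  source and target. The maps of an identity functor and of a composite functor do not refer to the
  direction of arrows, so taking opposites preserves both, and does so covariantly: the order of
  arrows inside each category is reversed, but not the direction of functors between categories.

  What remains is that \<^const>\<open>Cat\<close> is itself a category. The identity laws depend on the maps of a
  functor being extensional: composing with an identity functor restricts them to their domains,
  which leaves an extensional map unchanged.
\<close>

section \<open>The category of categories\<close>

lemma is_functor_id_functor:
  assumes "category C"
  shows "is_functor (id_functor C)"
proof -
  interpret category C by fact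
  have Dom_Obj: "f \<in> Arr C \<Longrightarrow> Dom C f \<in> Obj C" for f
    using Dom_type by blast
  have Cod_Obj: "f \<in> Arr C \<Longrightarrow> Cod C f \<in> Obj C" for f
    using Cod_type by blast
  have Id_Arr: "x \<in> Obj C \<Longrightarrow> Id C x \<in> Arr C" for x
    using Id_type by blast
  show ?thesis
    using assms Comp_closed
    by (intro is_functor.intro)
      (auto simp: id_functor_def Dom_Obj Cod_Obj Id_Arr composable_def)
qed

lemma (in is_functor) composable_ArrMap:
  assumes "composable (Source F) g f"
  shows "composable (Target F) (ArrMap F g) (ArrMap F f)"
  using assms ArrMap_type Dom_ArrMap Cod_ArrMap
  by (auto simp: composable_def)

lemma is_functor_comp_functor:
  assumes "is_functor G" and "is_functor F" and meet: "Target F = Source G"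
  shows "is_functor (comp_functor G F)"
proof -
  interpret F: is_functor F by fact
  interpret G: is_functor G by fact
  interpret S: category "Source F" by (rule F.category_Source)
  have Obj_F: "x \<in> Obj (Source F) \<Longrightarrow> ObjMap F x \<in> Obj (Source G)" for x
    using F.ObjMap_type meet by auto
  have Arr_F: "f \<in> Arr (Source F) \<Longrightarrow> ArrMap F f \<in> Arr (Source G)" for f
    using F.ArrMap_type meet by auto
  show ?thesis
  proof (rule is_functor.intro)
    show "category (Source (comp_functor G F))" "category (Target (comp_functor G F))"
      by (simp_all add: comp_functor_def F.category_Source G.category_Target)
    show "ObjMap (comp_functor G F)
        \<in> Obj (Source (comp_functor G F)) \<rightarrow>\<^sub>E Obj (Target (comp_functor G F))"
      using Obj_F G.ObjMap_type by (auto simp: comp_functor_def compose_def)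
    show "ArrMap (comp_functor G F)
        \<in> Arr (Source (comp_functor G F)) \<rightarrow>\<^sub>E Arr (Target (comp_functor G F))"
      using Arr_F G.ArrMap_type by (auto simp: comp_functor_def compose_def)
  next
    fix f assume "f \<in> Arr (Source (comp_functor G F))"
    then have f: "f \<in> Arr (Source F)" by (simp add: comp_functor_def)
    have ends: "Dom (Source F) f \<in> Obj (Source F)" "Cod (Source F) f \<in> Obj (Source F)"
      using f S.Dom_type S.Cod_type by auto
    show "Dom (Target (comp_functor G F)) (ArrMap (comp_functor G F) f) =
        ObjMap (comp_functor G F) (Dom (Source (comp_functor G F)) f)"
      using f ends F.Dom_ArrMap[OF f] G.Dom_ArrMap[OF Arr_F[OF f]] meet
      by (simp add: comp_functor_def compose_def)
    show "Cod (Target (comp_functor G F)) (ArrMap (comp_functor G F) f) =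
        ObjMap (comp_functor G F) (Cod (Source (comp_functor G F)) f)"
      using f ends F.Cod_ArrMap[OF f] G.Cod_ArrMap[OF Arr_F[OF f]] meet
      by (simp add: comp_functor_def compose_def)
  next
    fix x assume "x \<in> Obj (Source (comp_functor G F))"
    then have x: "x \<in> Obj (Source F)" by (simp add: comp_functor_def)
    have "Id (Source F) x \<in> Arr (Source F)"
      using x S.Id_type by auto
    then show "ArrMap (comp_functor G F) (Id (Source (comp_functor G F)) x) =
        Id (Target (comp_functor G F)) (ObjMap (comp_functor G F) x)"
      using x F.ArrMap_Id[OF x] G.ArrMap_Id[OF Obj_F[OF x]] meet
      by (simp add: comp_functor_def compose_def)
  next
    fix g f assume "composable (Source (comp_functor G F)) g f"
    then have gf: "composable (Source F) g f" by (simp add: comp_functor_def)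
    then have arrs: "g \<in> Arr (Source F)" "f \<in> Arr (Source F)"
      by (simp_all add: composable_def)
    have "composable (Source G) (ArrMap F g) (ArrMap F f)"
      using F.composable_ArrMap[OF gf] meet by simp
    then show "ArrMap (comp_functor G F) (Comp (Source (comp_functor G F)) g f) =
        Comp (Target (comp_functor G F)) (ArrMap (comp_functor G F) g) (ArrMap (comp_functor G F) f)"
      using arrs F.ArrMap_Comp[OF gf] S.Comp_closed[OF gf] G.ArrMap_Comp meet
      by (simp add: comp_functor_def compose_def)
  qed
qed

text \<open>
  Both sides are restricted to the source of \<open>F\<close>. The inner composite on the left is also restricted
  to the source of \<open>G\<close>, which is harmless because \<open>F\<close> maps into it.
\<close>

lemma comp_functor_assoc:
  assumes "is_functor F" and "Target F = Source G"
  shows "comp_functor (comp_functor H G) F = comp_functor H (comp_functor G F)"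
proof -
  interpret is_functor F by fact
  show ?thesis
    using ObjMap_type ArrMap_type assms(2)
    by (auto simp: comp_functor_def compose_def fun_eq_iff)
qed

lemma comp_functor_id_left:
  assumes "is_functor F"
  shows "comp_functor (id_functor (Target F)) F = F"
proof -
  interpret is_functor F by fact
  show ?thesis
    using ObjMap_type ArrMap_type
    by (auto simp: comp_functor_def id_functor_def PiE_def Id_compose)
qed

lemma comp_functor_id_right:
  assumes "is_functor F"
  shows "comp_functor F (id_functor (Source F)) = F"
proof -
  interpret is_functor F by fact
  show ?thesis
    using ObjMap_type ArrMap_type
    by (auto simp: comp_functor_def id_functor_def PiE_def compose_Id)
qed

lemma Cat_simps:
  "Obj Cat = {C. category C}"
  "Arr Cat = {F. is_functor F}"
  "is_functor F \<Longrightarrow> Dom Cat F = Source F"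
  "is_functor F \<Longrightarrow> Cod Cat F = Target F"
  "category C \<Longrightarrow> Id Cat C = id_functor C"
  by (simp_all add: Cat_def)

lemma composable_Cat:
  "composable Cat G F \<longleftrightarrow> is_functor G \<and> is_functor F \<and> Target F = Source G"
  by (auto simp: composable_def Cat_simps)

lemma Comp_Cat: "composable Cat G F \<Longrightarrow> Comp Cat G F = comp_functor G F"
  by (simp add: composable_Cat) (simp add: Cat_def)

lemma is_functor_Comp_Cat: "composable Cat G F \<Longrightarrow> is_functor (comp_functor G F)"
  by (simp add: composable_Cat is_functor_comp_functor)

lemma category_Cat: "category (Cat :: (('o, 'a) category, ('o, 'a, 'o, 'a) cat_functor) category)"
proof
  show "Dom Cat \<in> Arr Cat \<rightarrow>\<^sub>E Obj Cat" "Cod Cat \<in> Arr Cat \<rightarrow>\<^sub>E Obj Cat"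
    by (auto simp: Cat_def is_functor.category_Source is_functor.category_Target)
  show "Id Cat \<in> Obj Cat \<rightarrow>\<^sub>E Arr Cat"
    by (auto simp: Cat_def is_functor_id_functor)
next
  fix C :: "('o, 'a) category" assume "C \<in> Obj Cat"
  then have C: "category C" by (simp add: Cat_simps)
  then show "Dom Cat (Id Cat C) = C" "Cod Cat (Id Cat C) = C"
    by (simp_all add: Cat_simps is_functor_id_functor) (simp_all add: id_functor_def)
next
  fix G F :: "('o, 'a, 'o, 'a) cat_functor"
  assume GF: "composable Cat G F"
  show "Comp Cat G F \<in> Arr Cat"
    using GF by (simp add: Comp_Cat Cat_simps is_functor_Comp_Cat)
  have "is_functor G" "is_functor F"
    using GF by (simp_all add: composable_Cat)
  then show "Dom Cat (Comp Cat G F) = Dom Cat F" "Cod Cat (Comp Cat G F) = Cod Cat G"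
    using GF by (simp_all add: Comp_Cat Cat_simps is_functor_Comp_Cat)
      (simp_all add: comp_functor_def)
next
  fix G F :: "('o, 'a, 'o, 'a) cat_functor"
  assume "\<not> composable Cat G F"
  then show "Comp Cat G F = undefined"
    by (auto simp: composable_Cat) (auto simp: Cat_def)
next
  fix H G F :: "('o, 'a, 'o, 'a) cat_functor"
  assume HG: "composable Cat H G" and GF: "composable Cat G F"
  have "composable Cat (comp_functor H G) F" "composable Cat H (comp_functor G F)"
    using HG GF is_functor_Comp_Cat[OF HG] is_functor_Comp_Cat[OF GF]
    by (simp_all add: composable_Cat) (simp_all add: comp_functor_def)
  then show "Comp Cat (Comp Cat H G) F = Comp Cat H (Comp Cat G F)"
    using HG GF by (simp add: Comp_Cat) (simp add: composable_Cat comp_functor_assoc)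
next
  fix F :: "('o, 'a, 'o, 'a) cat_functor" assume "F \<in> Arr Cat"
  then have F: "is_functor F" by (simp add: Cat_simps)
  interpret is_functor F by fact
  have "composable Cat (id_functor (Target F)) F" "composable Cat F (id_functor (Source F))"
    using F category_Source category_Target
    by (simp_all add: composable_Cat is_functor_id_functor) (simp_all add: id_functor_def)
  then show "Comp Cat (Id Cat (Cod Cat F)) F = F" "Comp Cat F (Id Cat (Dom Cat F)) = F"
    using F category_Source category_Target
    by (simp_all add: Comp_Cat Cat_simps comp_functor_id_left comp_functor_id_right)
qed

section \<open>Opposite categories and functors\<close>

lemma composable_opposite: "composable (opposite C) g f \<longleftrightarrow> composable C f g"
  by (auto simp: composable_def opposite_def)

text \<open>
  The axioms of \<open>C\<close> come in dual pairs (domain and codomain, left and right unit), so each axiom of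
  the opposite is the dual axiom of \<open>C\<close>; associativity and the typing of identities and composites
  are self-dual.
\<close>

lemma category_opposite:
  assumes "category C"
  shows "category (opposite C)"
proof -
  interpret category C by fact
  show ?thesis
    by unfold_locales
      (use Dom_type Cod_type Id_type in \<open>simp_all add: composable_opposite\<close>,
       simp_all add: opposite_def Dom_Id Cod_Id Comp_closed Comp_undefined Dom_Comp Cod_Comp
         Comp_assoc Comp_Id_left Comp_Id_right)
qed

text \<open>
  Preservation of domains by the opposite functor is preservation of codomains by \<open>F\<close>, and vice
  versa; preservation of identities and of composites are self-dual.
\<close>

lemma is_functor_opposite_functor:
  assumes "is_functor F"
  shows "is_functor (opposite_functor F)"
proof -
  interpret is_functor F by fact
  show ?thesis
    using ObjMap_type ArrMap_type
    by (intro is_functor.intro)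
      (simp_all add: opposite_functor_def category_opposite category_Source category_Target
         composable_opposite,
       simp_all add: opposite_def Dom_ArrMap Cod_ArrMap ArrMap_Id ArrMap_Comp)
qed

lemma opposite_functor_id: "opposite_functor (id_functor C) = id_functor (opposite C)"
  by (simp add: opposite_functor_def id_functor_def opposite_def)

text \<open>
  The order of \<open>G\<close> and \<open>F\<close> is kept: the maps are composed as before, and taking opposites only
  relabels source and target. This is why the resulting functor is covariant.
\<close>

lemma opposite_functor_comp:
  "opposite_functor (comp_functor G F) = comp_functor (opposite_functor G) (opposite_functor F)"
  by (simp add: opposite_functor_def comp_functor_def opposite_def)

lemma composable_opposite_functor:
  "composable Cat G F \<Longrightarrow> composable Cat (opposite_functor G) (opposite_functor F)"
  by (simp add: composable_Cat is_functor_opposite_functor) (simp add: opposite_functor_def)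

theorem theorem5p5:
  "\<exists>OP :: (('o, 'a) category, ('o, 'a, 'o, 'a) cat_functor,
           ('o, 'a) category, ('o, 'a, 'o, 'a) cat_functor) cat_functor.
     is_functor OP \<and> Source OP = Cat \<and> Target OP = Cat \<and>
     (\<forall>C\<in>Obj Cat. ObjMap OP C = opposite C) \<and>
     (\<forall>F\<in>Arr Cat. ArrMap OP F = opposite_functor F)"
proof -
  define OP :: "(('o, 'a) category, ('o, 'a, 'o, 'a) cat_functor,
           ('o, 'a) category, ('o, 'a, 'o, 'a) cat_functor) cat_functor"
    where "OP = \<lparr>Source = Cat, Target = Cat,
      ObjMap = (\<lambda>C\<in>Obj Cat. opposite C), ArrMap = (\<lambda>F\<in>Arr Cat. opposite_functor F)\<rparr>"
  have OP_simps: "Source OP = Cat" "Target OP = Cat"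
    "\<And>C. category C \<Longrightarrow> ObjMap OP C = opposite C"
    "\<And>F. is_functor F \<Longrightarrow> ArrMap OP F = opposite_functor F"
    by (simp_all add: OP_def Cat_simps)
  have "is_functor OP"
  proof (rule is_functor.intro)
    show "category (Source OP)" "category (Target OP)"
      by (simp_all add: OP_simps category_Cat)
    show "ObjMap OP \<in> Obj (Source OP) \<rightarrow>\<^sub>E Obj (Target OP)"
      by (auto simp: OP_def Cat_simps category_opposite)
    show "ArrMap OP \<in> Arr (Source OP) \<rightarrow>\<^sub>E Arr (Target OP)"
      by (auto simp: OP_def Cat_simps is_functor_opposite_functor)
  next
    fix F assume "F \<in> Arr (Source OP)"
    then have F: "is_functor F" by (simp add: OP_simps Cat_simps)
    then show "Dom (Target OP) (ArrMap OP F) = ObjMap OP (Dom (Source OP) F)"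
      "Cod (Target OP) (ArrMap OP F) = ObjMap OP (Cod (Source OP) F)"
      by (simp_all add: OP_simps Cat_simps is_functor_opposite_functor
          is_functor.category_Source is_functor.category_Target)
        (simp_all add: opposite_functor_def)
  next
    fix C assume "C \<in> Obj (Source OP)"
    then have "category C" by (simp add: OP_simps Cat_simps)
    then show "ArrMap OP (Id (Source OP) C) = Id (Target OP) (ObjMap OP C)"
      by (simp add: OP_simps Cat_simps is_functor_id_functor category_opposite opposite_functor_id)
  next
    fix G F assume "composable (Source OP) G F"
    then have GF: "composable Cat G F" by (simp add: OP_simps)
    then have "is_functor G" "is_functor F"
      by (simp_all add: composable_Cat)
    then show "ArrMap OP (Comp (Source OP) G F) = Comp (Target OP) (ArrMap OP G) (ArrMap OP F)"
      using GF by (simp add: OP_simps Comp_Cat is_functor_Comp_Cat composable_opposite_functor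
          opposite_functor_comp)
  qed
  then show ?thesis
    by (intro exI[of _ OP]) (simp add: OP_simps Cat_simps)
qed

end
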